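(* Let the GADI-IR algorithm (described in the context) be applied to a linear system $Ax=b$ with a nonsingular matrix $A\in\mathbb{R}^{n\times n}$, and assume that the solver used for the two inner systems (with matrices $H$ and $S$) is backward stable. Then for every $k\ge 0$ the computed iterate $\hat x_{k+1}$ satisfies $$\frac{\|b-A\hat x_{k+1}\|}{\|A\|\,\|\hat x_{k+1}\|}\le\alpha_B\,\frac{\|b-A\hat x_k\|}{\|A\|\,\|\hat x_k\|}+\beta_B,$$ where $$\alpha_B=\gamma\big(\lambda+(2-\omega)\eta\hat\kappa(HS)+4(2-\omega)\hat\kappa(HS)u_r+4(2-\omega)\hat\kappa(HS)(1+u_r)u_f\big),$$ $$\beta_B=8(2-\omega)\gamma\hat\kappa(HS)(1+u_r)u_f+\varphi_2(n)\gamma u+\varphi_2(n)\big(1-\varphi_2(n)u\big)^{-1}u\,\big(1+(1+\varphi_2(n)u)\gamma\big),$$ and $$\hat\kappa(HS)=\kappa(H)\kappa(S)\,\frac{\alpha\|H\|+\alpha\|S\|+2\alpha^2}{\|H\|\,\|S\|}.$$ Here $\eta$ and $\varphi_2(n)$ are the quantities defined in the context; $\lambda<1$ is a number, whose existence is derived from $\rho(T(\alpha,\omega))<1$, such that $\|T(\alpha,\omega)(b-A\hat x_k)\|\le\lambda\|b-A\hat x_k\|$, with $T(\alpha,\omega)$ the iteration matrix defined in the context; and $\gamma$ is a number, whose existence is derived from the forward error analysis of the algorithm, such that $\|\hat x_k\|\le\gamma\|\hat x_{k+1}\|$.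
   Context: $\|\cdot\|$ is a vector norm and the induced operator norm on matrices; $\kappa(B)=\|B\|\,\|B^{-1}\|$ for nonsingular $B$; $\rho$ is the spectral radius. Splitting: $M,N\in\mathbb{C}^{n\times n}$ with $A=M+N$; $\alpha>0$, $\omega\in[0,2)$; $H=\alpha I+M$, $S=\alpha I+N$; $p=(2-\omega)\alpha$. GADI-IR algorithm (from a starting vector $\hat x_0$), at step $k$: compute the residual $\hat r_k\approx b-A\hat x_k$ (precision $u_f$, then rounded to precision $u_r$); solve $H\hat z_k\approx \hat r_k$ (precision $u_r$); solve $S\hat y_k\approx p\,\hat z_k$ (precision $u_r$); set $\hat x_{k+1}\approx\hat x_k+\hat y_k$ (precision $u$). Floating-point error model: for every $k\ge0$, $$\hat r_k=b-A\hat x_k+\Delta\hat r_k,\quad \|\Delta\hat r_k\|\le u_r\|b-A\hat x_k\|+(1+u_r)u_f(\|A\|\|\hat x_k\|+\|b\|),$$ $$\hat x_{k+1}=\hat x_k+\hat y_k+\Delta\hat x_k,\quad \|\Delta\hat x_k\|\le\varphi_2(n)\,u\,(\|\hat x_k\|+\|\hat y_k\|),$$ with $\varphi_2(n)$ depending only on $n$. Backward stability of the inner solver means that there are matrices $G_k,F_k$ with $$(H+G_k)\hat z_k=\hat r_k,\qquad (S+F_k)\hat y_k=p\,\hat z_k,\qquad \|G_k\|\le\phi(n)u_r\|M\|,\quad \|F_k\|\le\varphi(n)u_r\|N\|,$$ where $\phi(n),\varphi(n)$ are reasonably small functions of $n$. The precision $u_r$ is small enough (a fixed small function $\mu(n)$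 times $\kappa(S)u_r$, respectively $\kappa(H)u_r$, is less than $1/2$) that $H+G_k$ and $S+F_k$ are nonsingular and $$(S+F_k)^{-1}=S^{-1}(I+P_k),\quad (H+G_k)^{-1}=H^{-1}(I+Q_k),\quad \|P_k\|\le 1,\ \|Q_k\|\le 1.$$ Set $\eta=\|P_k\|+\|Q_k\|+\|P_k\|\|Q_k\|$. GADI iteration matrix: $T(\alpha,\omega)=(\alpha I+N)^{-1}(\alpha I+M)^{-1}\big(\alpha^2I+MN-(1-\omega)\alpha A\big)$. The quoted convergence theorem for the GADI framework (Jiang et al., 2022) states that $\rho(T(\alpha,\omega))<1$ for any $\alpha>0$ and $\omega\in[0,2)$.
   Formalization: As T propagates the error, not the residual, the claim fails as written; the formal theorem also requires ‖A T A⁻¹(b−Ax̂_k)‖ ≤ λ‖b−Ax̂_k‖ (the same condition if M, N commute). It makes φ₂(n)u<1, x̂_k≠0 and nonsingular H, S explicit, and takes λ and γ as given. *)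

theory Defs
  imports "HOL-Analysis.Analysis"
begin

text \<open>The type-class norm on \<^typ>\<open>complex ^ 'n\<close> is the Euclidean one, whereas here the norm is
  an arbitrary vector norm on complex n-space; hence the explicit predicate and the explicit
  induced norm.\<close>

definition vector_norm :: "(complex ^ 'n \<Rightarrow> real) \<Rightarrow> bool" where
  "vector_norm nrm \<longleftrightarrow>
     (\<forall>v. 0 \<le> nrm v) \<and>
     (\<forall>v. nrm v = 0 \<longleftrightarrow> v = 0) \<and>
     (\<forall>c v. nrm (c *s v) = cmod c * nrm v) \<and>
     (\<forall>v w. nrm (v + w) \<le> nrm v + nrm w)"

definition induced_norm :: "(complex ^ 'n \<Rightarrow> real) \<Rightarrow> complex ^ 'n ^ 'n \<Rightarrow> real" where
  "induced_norm nrm B = (SUP v\<in>{v. nrm v = 1}. nrm (B *v v))"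

definition cond_num :: "(complex ^ 'n \<Rightarrow> real) \<Rightarrow> complex ^ 'n ^ 'n \<Rightarrow> real" where
  "cond_num nrm B = induced_norm nrm B * induced_norm nrm (matrix_inv B)"

definition complex_matrix :: "real ^ 'n ^ 'n \<Rightarrow> complex ^ 'n ^ 'n" where
  "complex_matrix A = (\<chi> i j. complex_of_real (A $ i $ j))"

definition shifted :: "real \<Rightarrow> complex ^ 'n ^ 'n \<Rightarrow> complex ^ 'n ^ 'n" where
  "shifted \<alpha> B = \<alpha> *\<^sub>R mat 1 + B"

definition gadi_matrix ::
  "complex ^ 'n ^ 'n \<Rightarrow> complex ^ 'n ^ 'n \<Rightarrow> real \<Rightarrow> real \<Rightarrow> complex ^ 'n ^ 'n" where
  "gadi_matrix M N \<alpha> \<omega> =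
     matrix_inv (shifted \<alpha> N) ** matrix_inv (shifted \<alpha> M) **
       (\<alpha>\<^sup>2 *\<^sub>R mat 1 + M ** N - ((1 - \<omega>) * \<alpha>) *\<^sub>R (M + N))"

text \<open>The matrix \<^term>\<open>gadi_matrix M N \<alpha> \<omega>\<close> propagates the error \<open>x - x\<^sub>k\<close> of an exact
  sweep. The residual \<open>b - A x\<^sub>k\<close>, which is \<open>A\<close> times the error, is propagated by the similar
  matrix below. The two agree when \<open>M\<close> and \<open>N\<close> commute, but not in general.\<close>

definition gadi_residual_matrix ::
  "complex ^ 'n ^ 'n \<Rightarrow> complex ^ 'n ^ 'n \<Rightarrow> real \<Rightarrow> real \<Rightarrow> complex ^ 'n ^ 'n" where
  "gadi_residual_matrix M N \<alpha> \<omega> = (M + N) ** gadi_matrix M N \<alpha> \<omega> ** matrix_inv (M + N)"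

definition kappa_hat ::
  "(complex ^ 'n \<Rightarrow> real) \<Rightarrow> real \<Rightarrow> complex ^ 'n ^ 'n \<Rightarrow> complex ^ 'n ^ 'n \<Rightarrow> real" where
  "kappa_hat nrm \<alpha> H S =
     cond_num nrm H * cond_num nrm S *
       ((\<alpha> * induced_norm nrm H + \<alpha> * induced_norm nrm S + 2 * \<alpha>\<^sup>2) /
        (induced_norm nrm H * induced_norm nrm S))"

end

theory Submission
  imports Defs
begin

text \<open>Write \<open>s = b - A x\<^sub>k\<close>. Since \<open>H S = \<alpha>\<^sup>2 I + \<alpha> A + M N\<close>, the residual matrix is
  \<open>I - p A S\<^sup>-\<^sup>1 H\<^sup>-\<^sup>1\<close>, so that
  \<open>b - A x\<^sub>k\<^sub>+\<^sub>1 = (I - p A S\<^sup>-\<^sup>1 H\<^sup>-\<^sup>1) s - p A S\<^sup>-\<^sup>1 E s - p A S\<^sup>-\<^sup>1 (H\<^sup>-\<^sup>1 + E) \<Delta>r - A \<Delta>x\<close>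
  with \<open>E = (I + P) H\<^sup>-\<^sup>1 (I + Q) - H\<^sup>-\<^sup>1\<close>, whose norm is at most \<open>\<eta> \<parallel>H\<^sup>-\<^sup>1\<parallel>\<close>, where \<open>\<eta> \<le> 3\<close>.
  Because \<open>A = H + S - 2 \<alpha> I\<close>, the factor \<open>p \<parallel>A\<parallel> \<parallel>S\<^sup>-\<^sup>1\<parallel> \<parallel>H\<^sup>-\<^sup>1\<parallel>\<close> common to the middle terms is at
  most \<open>(2 - \<omega>)\<close> times the combined condition number. The update error is bounded by eliminating
  \<open>y = x\<^sub>k\<^sub>+\<^sub>1 - x\<^sub>k - \<Delta>x\<close> from its own estimate.\<close>

section \<open>Scalars, matrix action and inverses for complex matrices\<close>

lemma vector_scaleR_eq_scalar_mult: "c *\<^sub>R (v :: complex ^ 'n) = complex_of_real c *s v"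
  by (simp add: vec_eq_iff scaleR_conv_of_real[where 'a = complex])

lemma matrix_mult_vector_scaleR: "(B :: complex ^ 'n ^ 'm) *v (c *\<^sub>R v) = c *\<^sub>R (B *v v)"
  by (simp add: vector_scaleR_eq_scalar_mult vector_scalar_commute)

lemma scaleR_matrix_mult_vector: "(c *\<^sub>R (B :: complex ^ 'n ^ 'm)) *v v = c *\<^sub>R (B *v v)"
  unfolding vec_eq_iff by (simp add: matrix_vector_mult_def scaleR_sum_right)

lemma invertible_matrix_inv:
  fixes B :: "complex ^ 'n ^ 'n"
  assumes "invertible B"
  shows "B ** matrix_inv B = mat 1" and "matrix_inv B ** B = mat 1"
proof -
  have "B ** matrix_inv B = mat 1 \<and> matrix_inv B ** B = mat 1"
    using assms unfolding invertible_def matrix_inv_def by (rule someI_ex)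
  then show "B ** matrix_inv B = mat 1" and "matrix_inv B ** B = mat 1"
    by auto
qed

lemma matrix_inv_mult_vector:
  fixes B :: "complex ^ 'n ^ 'n"
  assumes "invertible B"
  shows "B *v (matrix_inv B *v v) = v" and "matrix_inv B *v (B *v v) = v"
  using invertible_matrix_inv[OF assms] by (simp_all add: matrix_vector_mul_assoc)

text \<open>The entrywise embedding respects products and the identity, so it carries a two-sided
  inverse of \<open>A\<close> to one of \<open>complex_matrix A\<close>.\<close>

lemma invertible_complex_matrix:
  assumes "invertible A"
  shows "invertible (complex_matrix A)"
proof -
  have mult: "complex_matrix B ** complex_matrix C = complex_matrix (B ** C)"
    for B C :: "real ^ 'n ^ 'n"
    unfolding vec_eq_iff by (simp add: complex_matrix_def matrix_matrix_mult_def)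
  have one: "complex_matrix (mat 1 :: real ^ 'n ^ 'n) = mat 1"
    unfolding vec_eq_iff by (simp add: complex_matrix_def mat_def)
  obtain B where "A ** B = mat 1" "B ** A = mat 1"
    using assms unfolding invertible_def by blast
  then show ?thesis
    unfolding invertible_def using mult one by metis
qed

lemma invertible_nonzero:
  fixes B :: "complex ^ 'n ^ 'n"
  assumes "invertible B"
  shows "B \<noteq> 0"
proof
  assume "B = 0"
  \<comment> \<open>\<open>undefined\<close> is just some index: any nonzero \<open>v\<close> would
    do, since \<open>B = 0\<close> turns \<open>B *v (matrix_inv B *v v) = v\<close> into
    \<open>v = 0\<close>.\<close>
  then have "axis undefined 1 = (0 :: complex ^ 'n)"
    using matrix_inv_mult_vector(1)[OF assms, of "axis undefined 1"] by simp
  then show False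
    by (simp add: axis_eq_0_iff)
qed

section \<open>Arbitrary vector norms and their induced matrix norms\<close>

context
  fixes nrm :: "complex ^ 'n \<Rightarrow> real"
  assumes norm: "vector_norm nrm"
begin

lemma nrm_nonneg: "0 \<le> nrm v"
  and nrm_eq_0_iff: "nrm v = 0 \<longleftrightarrow> v = 0"
  and nrm_scalar: "nrm (c *s v) = cmod c * nrm v"
  and nrm_triangle: "nrm (v + w) \<le> nrm v + nrm w"
  using norm unfolding vector_norm_def by auto

lemma nrm_0: "nrm 0 = 0"
  by (simp add: nrm_eq_0_iff)

lemma nrm_scaleR: "nrm (c *\<^sub>R v) = \<bar>c\<bar> * nrm v"
  by (simp add: vector_scaleR_eq_scalar_mult nrm_scalar)

lemma nrm_triangle_diff: "nrm (v - w) \<le> nrm v + nrm w"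
  using nrm_triangle[of v "(-1) *\<^sub>R w"] nrm_scaleR[of "-1" w] by simp

lemma nrm_sum: "nrm (\<Sum>i\<in>I. f i) \<le> (\<Sum>i\<in>I. nrm (f i))"
proof (induction I rule: infinite_finite_induct)
  case (insert i I)
  then show ?case
    using nrm_triangle[of "f i" "sum f I"] by simp
qed (simp_all add: nrm_0)

text \<open>Expansion in the standard basis: each coordinate is at most the Euclidean norm, so the
  sum of \<open>nrm\<close> over the basis vectors serves as \<open>C\<close>.\<close>

lemma nrm_le_norm: obtains C where "0 \<le> C" "\<And>v. nrm v \<le> C * norm v"
proof
  let ?C = "\<Sum>i\<in>UNIV. nrm (axis i 1)"
  show "0 \<le> ?C"
    by (simp add: sum_nonneg nrm_nonneg)
  show "nrm v \<le> ?C * norm v" for v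
  proof -
    have "nrm v = nrm (\<Sum>i\<in>UNIV. (v $ i) *s axis i 1)"
      by (simp add: basis_expansion)
    also have "\<dots> \<le> (\<Sum>i\<in>UNIV. cmod (v $ i) * nrm (axis i 1))"
      using nrm_sum[of "\<lambda>i. (v $ i) *s axis i 1" UNIV] by (simp add: nrm_scalar)
    also have "\<dots> \<le> (\<Sum>i\<in>UNIV. norm v * nrm (axis i 1))"
      by (intro sum_mono mult_right_mono Finite_Cartesian_Product.norm_nth_le nrm_nonneg)
    also have "\<dots> = ?C * norm v"
      by (simp add: sum_distrib_left mult.commute)
    finally show ?thesis .
  qed
qed

lemma continuous_on_nrm: "continuous_on X nrm"
proof -
  obtain C where C: "0 \<le> C" "\<And>v. nrm v \<le> C * norm v"
    using nrm_le_norm by blast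
  have "\<bar>nrm v - nrm w\<bar> \<le> C * norm (v - w)" for v w
    using nrm_triangle[of "v - w" w] nrm_triangle[of "w - v" v] C(2)[of "v - w"] C(2)[of "w - v"]
    by (simp add: norm_minus_commute)
  then have "C-lipschitz_on X nrm"
    by (intro lipschitz_onI) (simp_all add: C(1) dist_norm)
  then show ?thesis
    by (rule lipschitz_on_continuous_on)
qed

text \<open>The continuous function \<open>nrm\<close> attains a positive minimum on the compact
  Euclidean unit sphere; by homogeneity the inverse of that minimum serves as
  \<open>c\<close>.\<close>

lemma norm_le_nrm: obtains c where "0 < c" "\<And>v. norm v \<le> c * nrm v"
proof -
  let ?K = "sphere (0 :: complex ^ 'n) 1"
  have "norm (axis undefined 1 :: complex ^ 'n) = 1"
    by simp
  then have "axis undefined 1 \<in> ?K"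
    by simp
  then have "?K \<noteq> {}"
    by blast
  then obtain w where w: "w \<in> ?K" "\<And>v. v \<in> ?K \<Longrightarrow> nrm w \<le> nrm v"
    using continuous_attains_inf[OF compact_sphere _ continuous_on_nrm, of 0 1] by blast
  have "w \<noteq> 0"
    using w(1) by auto
  then have pos: "0 < nrm w"
    using nrm_nonneg[of w] nrm_eq_0_iff[of w] by linarith
  have "norm v \<le> inverse (nrm w) * nrm v" for v
  proof (cases "v = 0")
    case False
    then have "nrm w \<le> nrm (inverse (norm v) *\<^sub>R v)"
      by (intro w(2)) simp
    then have "nrm w \<le> nrm v / norm v"
      by (simp add: nrm_scaleR divide_inverse mult.commute)
    with False pos show ?thesis
      by (simp add: field_simps)
  qed (simp add: nrm_0)
  with pos show ?thesis
    by (intro that[of "inverse (nrm w)"]) auto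
qed

text \<open>The supremum in \<open>induced_norm\<close> can be used only for a nonempty set that is
  bounded above. Boundedness follows from the Euclidean case by comparing the two norms in both
  directions.\<close>

lemma bdd_above_induced_norm: "bdd_above ((\<lambda>v. nrm (B *v v)) ` {v. nrm v = 1})"
proof -
  obtain C where C: "0 \<le> C" "\<And>v. nrm v \<le> C * norm v"
    using nrm_le_norm by blast
  obtain c where c: "\<And>v. norm v \<le> c * nrm v"
    using norm_le_nrm by blast
  obtain K where K: "0 < K" "\<And>v. norm (B *v v) \<le> norm v * K"
    using bounded_linear.pos_bounded[OF matrix_vector_mul_bounded_linear[of B]] by blast
  have "nrm (B *v v) \<le> C * (c * K)" if "nrm v = 1" for v
  proof -
    have "norm (B *v v) \<le> norm v * K"
      by (rule K(2))
    also have "\<dots> \<le> c * K"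
      using c[of v] that K(1) by simp
    finally show ?thesis
      using C(2)[of "B *v v"] mult_left_mono[OF _ C(1)] by (meson order_trans)
  qed
  then show ?thesis
    by (intro bdd_aboveI2) auto
qed

lemma nrm_normalized: "v \<noteq> 0 \<Longrightarrow> nrm (inverse (nrm v) *\<^sub>R v) = 1"
  using nrm_nonneg[of v] nrm_eq_0_iff[of v] by (simp add: nrm_scaleR)

lemma nrm_eq_1_ex: obtains v where "nrm v = 1"
  using nrm_normalized[of "axis undefined 1"] by (auto simp: axis_eq_0_iff)

lemma nrm_matrix_mult_le: "nrm (B *v v) \<le> induced_norm nrm B * nrm v"
proof (cases "v = 0")
  case False
  then have pos: "0 < nrm v"
    using nrm_nonneg[of v] nrm_eq_0_iff[of v] by linarith
  have "nrm (B *v (inverse (nrm v) *\<^sub>R v)) \<le> induced_norm nrm B"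
    unfolding induced_norm_def
    by (rule cSUP_upper[OF _ bdd_above_induced_norm]) (simp add: nrm_normalized False)
  with pos show ?thesis
    by (simp add: matrix_mult_vector_scaleR nrm_scaleR field_simps)
qed (simp add: nrm_0)

lemma induced_norm_le:
  assumes "\<And>v. nrm (B *v v) \<le> K * nrm v"
  shows "induced_norm nrm B \<le> K"
proof -
  have ne: "{v. nrm v = 1} \<noteq> {}"
    using nrm_eq_1_ex by blast
  have "nrm (B *v v) \<le> K" if "v \<in> {v. nrm v = 1}" for v
    using assms[of v] that by simp
  then show ?thesis
    unfolding induced_norm_def by (rule cSUP_least[OF ne])
qed

lemma induced_norm_pos:
  assumes "B \<noteq> 0"
  shows "0 < induced_norm nrm B"
proof (rule ccontr)
  assume "\<not> 0 < induced_norm nrm B"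
  then have "nrm (B *v v) \<le> 0" for v
    using nrm_matrix_mult_le[of B v] mult_nonpos_nonneg[of "induced_norm nrm B" "nrm v"]
      nrm_nonneg[of v] by linarith
  \<comment> \<open>The right side is spelled as the action of the zero matrix because
    \<open>matrix_eq\<close> identifies matrices by their action on vectors.\<close>
  then have "B *v v = 0 *v v" for v
    using nrm_nonneg[of "B *v v"] nrm_eq_0_iff[of "B *v v"] by (simp add: order_antisym)
  then show False
    using assms matrix_eq by blast
qed

lemma induced_norm_nonneg: "0 \<le> induced_norm nrm B"
proof -
  obtain v where "nrm v = 1"
    using nrm_eq_1_ex .
  then show ?thesis
    using nrm_matrix_mult_le[of B v] nrm_nonneg[of "B *v v"] by simp
qed

section \<open>Estimates for perturbed products, condition numbers and updates\<close>

lemma nrm_perturbed_product_diff_le: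
  "nrm ((mat 1 + P) *v (B *v ((mat 1 + Q) *v v)) - B *v v)
     \<le> (induced_norm nrm P + induced_norm nrm Q + induced_norm nrm P * induced_norm nrm Q)
         * induced_norm nrm B * nrm v"
proof -
  let ?P = "induced_norm nrm P" and ?Q = "induced_norm nrm Q" and ?B = "induced_norm nrm B"
  \<comment> \<open>The terms \<open>P B\<close>, \<open>B Q\<close> and \<open>P B Q\<close> that
    remain after cancelling \<open>B\<close> produce the three summands of \<eta>.\<close>
  have "(mat 1 + P) *v (B *v ((mat 1 + Q) *v v)) - B *v v
      = P *v (B *v v) + B *v (Q *v v) + P *v (B *v (Q *v v))"
    by (simp add: algebra_simps matrix_vector_right_distrib)
  moreover have B: "nrm (B *v w) \<le> ?B * nrm w" for w
    by (rule nrm_matrix_mult_le)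
  moreover have BQ: "nrm (B *v (Q *v v)) \<le> ?B * (?Q * nrm v)"
    using B[of "Q *v v"] mult_left_mono[OF nrm_matrix_mult_le[of Q v] induced_norm_nonneg[of B]]
    by linarith
  moreover have "nrm (P *v (B *v v)) \<le> ?P * (?B * nrm v)"
    using nrm_matrix_mult_le[of P "B *v v"] mult_left_mono[OF B[of v] induced_norm_nonneg[of P]]
    by linarith
  moreover have "nrm (P *v (B *v (Q *v v))) \<le> ?P * (?B * (?Q * nrm v))"
    using nrm_matrix_mult_le[of P "B *v (Q *v v)"] mult_left_mono[OF BQ induced_norm_nonneg[of P]]
    by linarith
  moreover have "nrm (P *v (B *v v) + B *v (Q *v v) + P *v (B *v (Q *v v)))
      \<le> nrm (P *v (B *v v)) + nrm (B *v (Q *v v)) + nrm (P *v (B *v (Q *v v)))"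
    using nrm_triangle[of "P *v (B *v v) + B *v (Q *v v)" "P *v (B *v (Q *v v))"]
      nrm_triangle[of "P *v (B *v v)" "B *v (Q *v v)"] by linarith
  ultimately show ?thesis
    by (simp add: algebra_simps)
qed

text \<open>The bound on \<alpha> times the norm of \<open>M + N\<close> is the numerator of the
  fraction in \<open>kappa_hat\<close>. Invertible matrices have positive norm, so the denominator
  cancels against the condition numbers and leaves the norms of the two inverses.\<close>

lemma induced_norm_product_le_kappa_hat:
  assumes "0 < \<alpha>" "invertible (shifted \<alpha> M)" "invertible (shifted \<alpha> N)"
  shows "\<alpha> * induced_norm nrm (M + N) * induced_norm nrm (matrix_inv (shifted \<alpha> N))
      * induced_norm nrm (matrix_inv (shifted \<alpha> M))
    \<le> kappa_hat nrm \<alpha> (shifted \<alpha> M) (shifted \<alpha> N)"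
proof -
  let ?H = "shifted \<alpha> M" and ?S = "shifted \<alpha> N"
  have "nrm ((M + N) *v v) \<le> (induced_norm nrm ?H + induced_norm nrm ?S + 2 * \<alpha>) * nrm v" for v
  proof -
    have eq: "(M + N) *v v = ?H *v v + ?S *v v - (2 * \<alpha>) *\<^sub>R v"
      by (simp add: shifted_def algebra_simps scaleR_matrix_mult_vector flip: scaleR_add_left)
    show ?thesis
      unfolding eq
      using nrm_triangle_diff[of "?H *v v + ?S *v v" "(2 * \<alpha>) *\<^sub>R v"]
        nrm_triangle[of "?H *v v" "?S *v v"] nrm_matrix_mult_le[of ?H v]
        nrm_matrix_mult_le[of ?S v] assms(1)
      by (simp add: nrm_scaleR algebra_simps)
  qed
  then have "induced_norm nrm (M + N) \<le> induced_norm nrm ?H + induced_norm nrm ?S + 2 * \<alpha>"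
    by (rule induced_norm_le)
  then have "\<alpha> * induced_norm nrm (M + N)
      \<le> \<alpha> * induced_norm nrm ?H + \<alpha> * induced_norm nrm ?S + 2 * \<alpha>\<^sup>2"
    using mult_left_mono[of _ _ \<alpha>] assms(1) by (fastforce simp: algebra_simps power2_eq_square)
  then have "\<alpha> * induced_norm nrm (M + N) * (induced_norm nrm (matrix_inv ?S)
        * induced_norm nrm (matrix_inv ?H))
      \<le> (\<alpha> * induced_norm nrm ?H + \<alpha> * induced_norm nrm ?S + 2 * \<alpha>\<^sup>2)
        * (induced_norm nrm (matrix_inv ?S) * induced_norm nrm (matrix_inv ?H))"
    by (intro mult_right_mono mult_nonneg_nonneg induced_norm_nonneg)
  also have "\<dots> = kappa_hat nrm \<alpha> ?H ?S"
    using induced_norm_pos[of ?H] induced_norm_pos[of ?S] assms(2,3)[THEN invertible_nonzero]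
    by (simp add: kappa_hat_def cond_num_def)
  finally show ?thesis
    by (simp add: mult.assoc)
qed

lemma update_error_bound:
  assumes upd: "x' = x + y + d"
    and err: "nrm d \<le> e * (nrm x + nrm y)"
    and e: "0 \<le> e" "e < 1"
  shows "nrm d \<le> e * nrm x + e * inverse (1 - e) * (nrm x' + (1 + e) * nrm x)"
proof -
  have y: "y = x' - x - d"
    using upd by (simp add: algebra_simps)
  have "nrm y \<le> nrm x' + nrm x + nrm d"
    unfolding y using nrm_triangle_diff[of "x' - x" d] nrm_triangle_diff[of x' x] by linarith
  \<comment> \<open>The error \<open>d\<close> hidden in \<open>y\<close> contributes at most
    \<open>e * nrm x + e * nrm y\<close>. As \<open>e < 1\<close>, the last term is absorbed on the
    left, which is the source of \<open>inverse (1 - e)\<close>.\<close>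
  with err have "(1 - e) * nrm y \<le> nrm x' + (1 + e) * nrm x"
    by (simp add: algebra_simps)
  then have "nrm y \<le> inverse (1 - e) * (nrm x' + (1 + e) * nrm x)"
    using e by (simp add: field_simps)
  then have "e * nrm y \<le> e * (inverse (1 - e) * (nrm x' + (1 + e) * nrm x))"
    using e by (intro mult_left_mono)
  with err show ?thesis
    by (simp add: algebra_simps)
qed

end

text \<open>With \<open>s = (M + N) w\<close> and \<open>p = (2 - \<omega>) \<alpha>\<close>, the
  bracket in \<open>gadi_matrix\<close> is \<open>H S - p (M + N)\<close>, because
  \<open>\<alpha> + (1 - \<omega>) \<alpha> = p\<close>. Applied to \<open>w\<close> and multiplied
  by the inverses it gives \<open>w - p S^-1 H^-1 s\<close>; a final factor \<open>M + N\<close>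
  yields the claim.\<close>

lemma gadi_residual_matrix_mult_vector:
  assumes "invertible (M + N)" "invertible (shifted \<alpha> M)" "invertible (shifted \<alpha> N)"
  shows "gadi_residual_matrix M N \<alpha> \<omega> *v s
    = s - ((2 - \<omega>) * \<alpha>) *\<^sub>R
        ((M + N) *v (matrix_inv (shifted \<alpha> N) *v (matrix_inv (shifted \<alpha> M) *v s)))"
proof -
  define w where "w = matrix_inv (M + N) *v s"
  have s: "s = (M + N) *v w"
    unfolding w_def by (simp add: matrix_inv_mult_vector assms)
  have "(\<alpha>\<^sup>2 *\<^sub>R mat 1 + M ** N - ((1 - \<omega>) * \<alpha>) *\<^sub>R (M + N)) *v w
      = shifted \<alpha> M *v (shifted \<alpha> N *v w) - ((2 - \<omega>) * \<alpha>) *\<^sub>R s"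
    unfolding s shifted_def
    by (simp add: matrix_vector_mult_add_rdistrib matrix_vector_mult_diff_rdistrib
        scaleR_matrix_mult_vector matrix_vector_right_distrib matrix_mult_vector_scaleR
        flip: matrix_vector_mul_assoc)
      (simp add: vec_eq_iff scaleR_conv_of_real[where 'a = complex] power2_eq_square algebra_simps)
  then show ?thesis
    using assms(2,3)
    by (simp add: gadi_residual_matrix_def gadi_matrix_def w_def[symmetric]
        matrix_vector_mult_diff_distrib matrix_mult_vector_scaleR matrix_inv_mult_vector
        s[symmetric] flip: matrix_vector_mul_assoc)
qed

theorem theorem2p6:
  fixes nrm :: "complex ^ 'n \<Rightarrow> real"
    and A :: "real ^ 'n ^ 'n"
    and AC M N H S :: "complex ^ 'n ^ 'n"
    and b :: "complex ^ 'n"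
    and \<alpha> \<omega> p u\<^sub>f u\<^sub>r u :: real
    and phi psi phi2 :: "nat \<Rightarrow> real"
    and x r z y dr dx :: "nat \<Rightarrow> complex ^ 'n"
    and G F P Q :: "nat \<Rightarrow> complex ^ 'n ^ 'n"
    and eta :: "nat \<Rightarrow> real"
    and lam \<gamma> \<alpha>\<^sub>B \<beta>\<^sub>B :: real
    and k :: nat
  assumes norm: "vector_norm nrm"
    and A_nonsing: "invertible A"
    and AC: "AC = complex_matrix A"
    and splitting: "AC = M + N"
    and alpha: "0 < \<alpha>"
    and omega: "0 \<le> \<omega>" "\<omega> < 2"
    and H: "H = shifted \<alpha> M" "invertible H"
    and S: "S = shifted \<alpha> N" "invertible S"
    and p: "p = (2 - \<omega>) * \<alpha>"
    and precisions: "0 < u\<^sub>f" "0 < u\<^sub>r" "0 < u"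
    and residual: "\<And>j. r j = b - AC *v x j + dr j"
    and residual_error: "\<And>j. nrm (dr j) \<le> u\<^sub>r * nrm (b - AC *v x j)
           + (1 + u\<^sub>r) * u\<^sub>f * (induced_norm nrm AC * nrm (x j) + nrm b)"
    and update: "\<And>j. x (Suc j) = x j + y j + dx j"
    and update_error: "\<And>j. nrm (dx j) \<le> phi2 CARD('n) * u * (nrm (x j) + nrm (y j))"
    and solve_H: "\<And>j. (H + G j) *v z j = r j"
    and solve_S: "\<And>j. (S + F j) *v y j = p *\<^sub>R z j"
    and backward_H: "\<And>j. induced_norm nrm (G j) \<le> phi CARD('n) * u\<^sub>r * induced_norm nrm M"
    and backward_S: "\<And>j. induced_norm nrm (F j) \<le> psi CARD('n) * u\<^sub>r * induced_norm nrm N"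
    and perturbed_nonsing: "\<And>j. invertible (H + G j)" "\<And>j. invertible (S + F j)"
    and P: "\<And>j. matrix_inv (S + F j) = matrix_inv S ** (mat 1 + P j)"
           "\<And>j. induced_norm nrm (P j) \<le> 1"
    and Q: "\<And>j. matrix_inv (H + G j) = matrix_inv H ** (mat 1 + Q j)"
           "\<And>j. induced_norm nrm (Q j) \<le> 1"
    and eta: "\<And>j. eta j = induced_norm nrm (P j) + induced_norm nrm (Q j)
           + induced_norm nrm (P j) * induced_norm nrm (Q j)"
    and update_precision: "phi2 CARD('n) * u < 1"
    and iterate_nonzero: "x k \<noteq> 0"
    and lam_less_1: "lam < 1"
    and lam: "nrm (gadi_matrix M N \<alpha> \<omega> *v (b - AC *v x k)) \<le> lam * nrm (b - AC *v x k)"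
    and lam_residual: "nrm (gadi_residual_matrix M N \<alpha> \<omega> *v (b - AC *v x k))
           \<le> lam * nrm (b - AC *v x k)"
    and gamma: "nrm (x k) \<le> \<gamma> * nrm (x (Suc k))"
    and alpha_B: "\<alpha>\<^sub>B = \<gamma> * (lam + (2 - \<omega>) * eta k * kappa_hat nrm \<alpha> H S
           + 4 * (2 - \<omega>) * kappa_hat nrm \<alpha> H S * u\<^sub>r
           + 4 * (2 - \<omega>) * kappa_hat nrm \<alpha> H S * (1 + u\<^sub>r) * u\<^sub>f)"
    and beta_B: "\<beta>\<^sub>B = 8 * (2 - \<omega>) * \<gamma> * kappa_hat nrm \<alpha> H S * (1 + u\<^sub>r) * u\<^sub>f
           + phi2 CARD('n) * \<gamma> * u
           + phi2 CARD('n) * inverse (1 - phi2 CARD('n) * u) * u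
               * (1 + (1 + phi2 CARD('n) * u) * \<gamma>)"
  shows "nrm (b - AC *v x (Suc k)) / (induced_norm nrm AC * nrm (x (Suc k)))
           \<le> \<alpha>\<^sub>B * (nrm (b - AC *v x k) / (induced_norm nrm AC * nrm (x k))) + \<beta>\<^sub>B"
proof -
  note tri = nrm_triangle[OF norm] nrm_triangle_diff[OF norm] and nonneg = nrm_nonneg[OF norm]
    and mv = nrm_matrix_mult_le[OF norm] and inn = induced_norm_nonneg[OF norm]
  let ?Hi = "matrix_inv H" and ?Si = "matrix_inv S" and ?e = "phi2 CARD('n) * u"
  let ?Pk = "mat 1 + P k" and ?Qk = "mat 1 + Q k"
  define s where "s = b - AC *v x k"
  define a where "a = induced_norm nrm AC"
  define K where "K = (2 - \<omega>) * kappa_hat nrm \<alpha> H S"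
  \<comment> \<open>This is the operator \<open>H^-1 + E\<close>, stopping short of
    \<open>S^-1\<close>, so that \<open>y k\<close> becomes \<open>p S^-1\<close> applied to
    \<open>t (r k)\<close>.\<close>
  define t where "t v = ?Pk *v (?Hi *v (?Qk *v v))" for v
  have inv_AC: "invertible AC"
    unfolding AC by (rule invertible_complex_matrix[OF A_nonsing])
  have a_pos: "0 < a"
    unfolding a_def by (intro induced_norm_pos[OF norm] invertible_nonzero inv_AC)
  have x_pos: "0 < nrm (x k)"
    using iterate_nonzero nonneg[of "x k"] nrm_eq_0_iff[OF norm, of "x k"] by linarith
  \<comment> \<open>Since \<open>x k\<close> is nonzero, the bound by \<gamma> forces both \<gamma>
    and the norm of the next iterate to be positive, so the later divisions are legitimate.\<close>
  have "0 < \<gamma> * nrm (x (Suc k))"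
    using x_pos gamma by linarith
  then have g_pos: "0 < \<gamma>" and x'_pos: "0 < nrm (x (Suc k))"
    using nonneg[of "x (Suc k)"] by (auto simp: zero_less_mult_iff)
  \<comment> \<open>The sign of \<open>?e\<close> is read off from the update error: its bound
    dominates a norm, while the factor beside \<open>?e\<close> is positive.\<close>
  have "0 \<le> ?e * (nrm (x k) + nrm (y k))"
    using update_error[of k] nonneg[of "dx k"] by linarith
  then have e_nonneg: "0 \<le> ?e"
    using x_pos nonneg[of "y k"] by (simp add: zero_le_mult_iff)

  \<comment> \<open>The common factor of the error terms\<close>
  have p_nonneg: "0 \<le> p"
    using p alpha omega by simp
  have "(2 - \<omega>) * (\<alpha> * a * induced_norm nrm ?Si * induced_norm nrm ?Hi) \<le> K"
    unfolding K_def a_def splitting H(1) S(1) using alpha omega H S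
    by (intro mult_left_mono induced_norm_product_le_kappa_hat[OF norm]) auto
  then have factor: "p * a * induced_norm nrm ?Si * induced_norm nrm ?Hi \<le> K"
    by (simp add: p mult.assoc)
  have "0 \<le> p * a * induced_norm nrm ?Si * induced_norm nrm ?Hi"
    using p_nonneg a_pos inn by simp
  with factor have K_nonneg: "0 \<le> K"
    by linarith
  \<comment> \<open>Measuring \<open>w\<close> in units of the norm of \<open>H^-1\<close> lets
    \<open>K\<close> absorb the whole product. It is used with \<open>c = eta k * nrm s\<close> for
    the solver error and \<open>c = 4 * nrm (dr k)\<close> for the residual error.\<close>
  have AS: "nrm (p *\<^sub>R (AC *v (?Si *v w))) \<le> K * c"
    if "nrm w \<le> c * induced_norm nrm ?Hi" "0 \<le> c" for w c
  proof -
    have "nrm (AC *v (?Si *v w)) \<le> a * nrm (?Si *v w)"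
      unfolding a_def by (rule mv)
    also have "\<dots> \<le> a * (induced_norm nrm ?Si * nrm w)"
      using a_pos by (intro mult_left_mono mv) simp
    also have "\<dots> \<le> a * (induced_norm nrm ?Si * (c * induced_norm nrm ?Hi))"
      using a_pos that by (intro mult_left_mono inn) simp_all
    finally have "p * nrm (AC *v (?Si *v w))
        \<le> p * (a * (induced_norm nrm ?Si * (c * induced_norm nrm ?Hi)))"
      using p_nonneg by (rule mult_left_mono)
    also have "\<dots> = p * a * induced_norm nrm ?Si * induced_norm nrm ?Hi * c"
      by simp
    also have "\<dots> \<le> K * c"
      using factor that(2) by (rule mult_right_mono)
    finally show ?thesis
      using p_nonneg by (simp add: nrm_scaleR[OF norm])
  qed

  \<comment> \<open>Perturbation of the two inner solves\<close>
  have eta_nonneg: "0 \<le> eta k"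
    unfolding eta using inn by simp
  have "induced_norm nrm (P k) * induced_norm nrm (Q k) \<le> 1 * 1"
    by (intro mult_mono P Q inn) simp
  then have eta_le: "eta k \<le> 3"
    unfolding eta using P(2)[of k] Q(2)[of k] by linarith
  have t_diff: "nrm (t v - ?Hi *v v) \<le> eta k * induced_norm nrm ?Hi * nrm v" for v
    unfolding t_def eta by (rule nrm_perturbed_product_diff_le[OF norm])
  \<comment> \<open>The constant is 1 for \<open>H^-1\<close> itself plus 3 for \<eta>; it is the 4
    of \<open>\<alpha>\<^sub>B\<close>.\<close>
  have t_bound: "nrm (t v) \<le> 4 * nrm v * induced_norm nrm ?Hi" for v
  proof -
    have "eta k * (induced_norm nrm ?Hi * nrm v) \<le> 3 * (induced_norm nrm ?Hi * nrm v)"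
      using eta_le nonneg inn by (intro mult_right_mono) simp_all
    then show ?thesis
      using tri(1)[of "t v - ?Hi *v v" "?Hi *v v"] t_diff[of v] mv[of ?Hi v]
      by (simp add: algebra_simps)
  qed

  \<comment> \<open>Exact recursion for the residual\<close>
  have "z k = ?Hi *v (?Qk *v r k)"
    using matrix_inv_mult_vector(2)[OF perturbed_nonsing(1), of k "z k"]
    by (simp add: solve_H Q matrix_vector_mul_assoc)
  moreover have "y k = p *\<^sub>R (?Si *v (?Pk *v z k))"
    using matrix_inv_mult_vector(2)[OF perturbed_nonsing(2), of k "y k"]
    by (simp add: solve_S P matrix_vector_mul_assoc matrix_mult_vector_scaleR)
  ultimately have "y k = p *\<^sub>R (?Si *v t (r k))"
    by (simp add: t_def)
  \<comment> \<open>Linearity of \<open>t\<close> separates the exact sweep, the solver error on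
    \<open>s\<close>, and the error made in computing the residual.\<close>
  also have "t (r k) = ?Hi *v s + (t s - ?Hi *v s) + t (dr k)"
    unfolding residual s_def[symmetric] by (simp add: t_def matrix_vector_right_distrib)
  finally have "AC *v y k = p *\<^sub>R (AC *v (?Si *v (?Hi *v s)))
      + p *\<^sub>R (AC *v (?Si *v (t s - ?Hi *v s))) + p *\<^sub>R (AC *v (?Si *v t (dr k)))"
    by (simp only: matrix_vector_right_distrib matrix_mult_vector_scaleR scaleR_right_distrib)
  moreover have "gadi_residual_matrix M N \<alpha> \<omega> *v s
      = s - p *\<^sub>R (AC *v (?Si *v (?Hi *v s)))"
    using gadi_residual_matrix_mult_vector[of M N \<alpha> \<omega> s] inv_AC H S by (simp add: splitting p)
  moreover have "b - AC *v x (Suc k) = s - AC *v y k - AC *v dx k"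
    by (simp add: update s_def matrix_vector_right_distrib)
  ultimately have "b - AC *v x (Suc k) = gadi_residual_matrix M N \<alpha> \<omega> *v s
      - p *\<^sub>R (AC *v (?Si *v (t s - ?Hi *v s))) - p *\<^sub>R (AC *v (?Si *v t (dr k))) - AC *v dx k"
    by (simp only: diff_diff_eq add.assoc)
  then have split: "nrm (b - AC *v x (Suc k)) \<le> nrm (gadi_residual_matrix M N \<alpha> \<omega> *v s)
      + nrm (p *\<^sub>R (AC *v (?Si *v (t s - ?Hi *v s)))) + nrm (p *\<^sub>R (AC *v (?Si *v t (dr k))))
      + nrm (AC *v dx k)"
    by (smt (verit) tri(2))

  \<comment> \<open>Bounds for the individual terms\<close>
  have T_s: "nrm (gadi_residual_matrix M N \<alpha> \<omega> *v s) \<le> lam * nrm s"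
    using lam_residual unfolding s_def .
  have solve_part: "nrm (p *\<^sub>R (AC *v (?Si *v (t s - ?Hi *v s)))) \<le> K * (eta k * nrm s)"
    using t_diff[of s] eta_nonneg nonneg[of s] by (intro AS) (simp_all add: mult_ac)
  \<comment> \<open>Eliminating \<open>nrm b\<close> sends a share of \<open>nrm s\<close> into
    \<open>\<alpha>\<^sub>B\<close> and doubles \<open>a * nrm (x k)\<close>; together with the 4
    above this makes the 8 of \<open>\<beta>\<^sub>B\<close>.\<close>
  have "nrm b \<le> nrm s + a * nrm (x k)"
    using tri(1)[of s "AC *v x k"] mv[of AC "x k"] by (simp add: s_def a_def)
  then have "(1 + u\<^sub>r) * u\<^sub>f * (a * nrm (x k) + nrm b)
      \<le> (1 + u\<^sub>r) * u\<^sub>f * (2 * (a * nrm (x k)) + nrm s)"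
    using precisions by (intro mult_left_mono) simp_all
  then have dr_bound:
    "nrm (dr k) \<le> u\<^sub>r * nrm s + (1 + u\<^sub>r) * u\<^sub>f * (2 * (a * nrm (x k)) + nrm s)"
    using residual_error[of k] by (simp add: s_def a_def)
  have "nrm (p *\<^sub>R (AC *v (?Si *v t (dr k)))) \<le> K * (4 * nrm (dr k))"
    using t_bound nonneg by (intro AS) simp_all
  also have "\<dots> \<le> K * (4 * (u\<^sub>r * nrm s + (1 + u\<^sub>r) * u\<^sub>f * (2 * (a * nrm (x k)) + nrm s)))"
    using dr_bound K_nonneg by (intro mult_left_mono) simp_all
  finally have residual_part: "nrm (p *\<^sub>R (AC *v (?Si *v t (dr k))))
      \<le> K * (4 * (u\<^sub>r * nrm s + (1 + u\<^sub>r) * u\<^sub>f * (2 * (a * nrm (x k)) + nrm s)))" .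
  have "nrm (dx k) \<le> ?e * nrm (x k)
      + ?e * inverse (1 - ?e) * (nrm (x (Suc k)) + (1 + ?e) * nrm (x k))"
    using update_error_bound[OF norm update update_error e_nonneg update_precision] .
  then have "a * nrm (dx k) \<le> a * (?e * nrm (x k)
      + ?e * inverse (1 - ?e) * (nrm (x (Suc k)) + (1 + ?e) * nrm (x k)))"
    using a_pos by (intro mult_left_mono) simp_all
  then have update_part: "nrm (AC *v dx k) \<le> a * (?e * nrm (x k)
      + ?e * inverse (1 - ?e) * (nrm (x (Suc k)) + (1 + ?e) * nrm (x k)))"
    using mv[of AC "dx k"] by (simp add: a_def)

  \<comment> \<open>Passage to relative residuals\<close>
  define c where "c = lam + K * eta k + 4 * K * u\<^sub>r + 4 * K * (1 + u\<^sub>r) * u\<^sub>f"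
  define d where "d = 8 * K * (1 + u\<^sub>r) * u\<^sub>f"
  define f where "f = ?e * inverse (1 - ?e)"
  \<comment> \<open>Up to the factor \<open>a\<close>, \<open>h\<close> and \<open>f\<close> are the
    coefficients of \<open>nrm (x k)\<close> and \<open>nrm (x (Suc k))\<close>; after the division
    they combine to \<open>h * \<gamma> + f\<close>, which is
    \<open>\<beta>\<^sub>B\<close>.\<close>
  define h where "h = d + ?e + f * (1 + ?e)"
  have total: "nrm (b - AC *v x (Suc k))
      \<le> c * nrm s + a * (h * nrm (x k) + f * nrm (x (Suc k)))"
    using split T_s solve_part residual_part update_part
    unfolding c_def d_def h_def f_def by (simp add: algebra_simps)
  \<comment> \<open>\<open>lam\<close> itself may be negative when \<open>s = 0\<close>, so only the
    product with \<open>nrm s\<close> is shown nonnegative, as an upper bound of a norm.\<close>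
  have "0 \<le> lam * nrm s"
    using T_s nonneg[of "gadi_residual_matrix M N \<alpha> \<omega> *v s"] by linarith
  moreover have "0 \<le> (K * eta k + 4 * K * u\<^sub>r + 4 * K * (1 + u\<^sub>r) * u\<^sub>f) * nrm s"
    using K_nonneg eta_nonneg precisions nonneg by (intro mult_nonneg_nonneg add_nonneg_nonneg) auto
  ultimately have c_nonneg: "0 \<le> c * nrm s"
    by (simp add: c_def algebra_simps)
  have f_nonneg: "0 \<le> f"
    using e_nonneg update_precision by (simp add: f_def)
  then have h_nonneg: "0 \<le> h"
    using e_nonneg K_nonneg precisions by (simp add: h_def d_def)
  \<comment> \<open>The first form replaces the new iterate by the old one in the denominator under
    the residual; the second bounds the factor that multiplies \<open>h\<close>.\<close>
  have ratio: "1 / nrm (x (Suc k)) \<le> \<gamma> / nrm (x k)" "nrm (x k) / nrm (x (Suc k)) \<le> \<gamma>"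
    using gamma x_pos x'_pos by (simp_all add: field_simps)
  have "nrm (b - AC *v x (Suc k)) / (a * nrm (x (Suc k)))
      \<le> (c * nrm s + a * (h * nrm (x k) + f * nrm (x (Suc k)))) / (a * nrm (x (Suc k)))"
    using total a_pos x'_pos by (intro divide_right_mono) simp_all
  also have "\<dots> = c * nrm s / a * (1 / nrm (x (Suc k))) + h * (nrm (x k) / nrm (x (Suc k))) + f"
    using a_pos x'_pos by (simp add: field_simps)
  also have "\<dots> \<le> c * nrm s / a * (\<gamma> / nrm (x k)) + h * \<gamma> + f"
    using a_pos c_nonneg h_nonneg ratio by (intro add_mono mult_left_mono) simp_all
  also have "\<dots> = \<gamma> * c * (nrm s / (a * nrm (x k))) + (h * \<gamma> + f)"
    by simp
  also have "\<gamma> * c = \<alpha>\<^sub>B"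
    unfolding alpha_B c_def K_def by (simp add: algebra_simps)
  also have "h * \<gamma> + f = \<beta>\<^sub>B"
    unfolding beta_B h_def d_def f_def K_def by (simp add: algebra_simps)
  finally show ?thesis
    unfolding a_def s_def .
qed

end
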